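(* Let $(U,\gamma)$ be a parallelism structure on $U$, with Cartan torsion field $\mathbf{\Theta}$ and Cartan connection operator of second kind $\gamma^{-}$. For any $c\in\mathcal{V}(U)$, $$\mathbf{\Theta}(c)=\partial_o\wedge c+\partial_s\wedge\gamma^{-}(s,c),$$ where $\partial_s\wedge\gamma^{-}(s,c)=\sum_{\mu}b_\mu\wedge\gamma^{-}(b_\mu,c)$.
   Context: $M$ is an $n$-dimensional smooth manifold, $(U_o,\phi_o)$ a chart with coordinates $x^1,\dots,x^n$, and $U\subset U_o$ open. The canonical space $\mathcal{U}_o$ is an $n$-dimensional real vector space with basis $b_1,\dots,b_n$ and the Euclidean scalar product $b_\mu\cdot b_\nu=\delta_{\mu\nu}$. $\mathcal{S}(U),\mathcal{V}(U),\mathcal{M}(U)$ denote smooth maps from $U$ to $\mathbb{R},\mathcal{U}_o,\bigwedge\mathcal{U}_o$. For $a\in\mathcal{U}_o$ (or pointwise for $a\in\mathcal V(U)$), $a\cdot\partial_o X=\sum_\mu(a\cdot b_\mu)\,\partial X/\partial x^\mu$ (componentwise), and $\partial_o\wedge X=\sum_\mu b_\mu\wedge\partial X/\partial x^\mu$. The Lie bracket is $[a,b]=a\cdot\partial_ob-b\cdot\partial_oa$. A parallelism structure $(U,\gamma)$ consists of $U$ and a connection field $\gamma$: a smooth map on $U$ with values bilinear maps $\mathcal{U}_o\times\mathcal{U}_o\to\mathcal{U}_o$; $\gamma_a(b)=\gamma(a,b)$, and ${}^\dagger$ is the Euclidean adjoint. On vector fields $b$: $\nabla_a^{+}b=a\cdot\partial_ob+\gamma_a(b)$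 and $\nabla_a^{-}b=a\cdot\partial_ob-\gamma_a^{\dagger}(b)$. Torsion field: $\tau(a,b)=\nabla_a^{+}b-\nabla_b^{+}a-[a,b]=\gamma_a(b)-\gamma_b(a)$. The symbol $\partial_a$ denotes differentiation with respect to a vector variable $a$; applied to an expression $F(a)$ linear in $a$ it means $\partial_a\ast F(a)=\sum_\mu b_\mu\ast F(b_\mu)$ ($\ast$ any product). Cartan torsion field: $\mathbf{\Theta}(c)=\frac12\,\partial_a\wedge\partial_b\,(\tau(a,b)\cdot c)=\frac12\sum_{\mu,\nu}(\tau(b_\mu,b_\nu)\cdot c)\,b_\mu\wedge b_\nu$. Cartan connection operator of second kind: $\gamma^{-}(b,c)=\partial_a\,\bigl(b\cdot(\nabla_a^{-}c)\bigr)=\sum_\mu\bigl(b\cdot\nabla_{b_\mu}^{-}c\bigr)b_\mu$ for $b,c\in\mathcal{V}(U)$. *)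

theory Defs
  imports "HOL-Analysis.Analysis"
begin

section \<open>Smooth manifolds\<close>

text \<open>\<open>Ck_on k S f\<close> is intended for open \<open>S\<close>: \<open>f\<close> is of class C^k on \<open>S\<close>.\<close>

primrec Ck_on :: "nat \<Rightarrow> 'a::euclidean_space set \<Rightarrow> ('a \<Rightarrow> 'b::real_normed_vector) \<Rightarrow> bool" where
  "Ck_on 0 S f \<longleftrightarrow> continuous_on S f"
| "Ck_on (Suc k) S f \<longleftrightarrow> f differentiable_on S \<and>
     (\<forall>i\<in>Basis. Ck_on k S (\<lambda>x. frechet_derivative f (at x) i))"

definition smooth_on :: "'a::euclidean_space set \<Rightarrow> ('a \<Rightarrow> 'b::real_normed_vector) \<Rightarrow> bool" where
  "smooth_on S f \<longleftrightarrow> (\<forall>k. Ck_on k S f)"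

text \<open>A chart is a pair of an open domain and a coordinate map; the values of the coordinate map
  outside the domain are irrelevant.\<close>

type_synonym ('m, 'n) chart = "'m set \<times> ('m \<Rightarrow> real ^ 'n)"

definition is_chart :: "('m::topological_space, 'n::finite) chart \<Rightarrow> bool" where
  "is_chart = (\<lambda>(V, \<psi>). open V \<and> open (\<psi> ` V) \<and> homeomorphism V (\<psi> ` V) \<psi> (inv_into V \<psi>))"

definition smooth_compatible ::
    "('m::topological_space, 'n::finite) chart \<Rightarrow> ('m, 'n) chart \<Rightarrow> bool" where
  "smooth_compatible = (\<lambda>(V, \<psi>) (W, \<eta>).
     smooth_on (\<psi> ` (V \<inter> W)) (\<eta> \<circ> inv_into V \<psi>) \<and>
     smooth_on (\<eta> ` (V \<inter> W)) (\<psi> \<circ> inv_into W \<eta>))"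

text \<open>A smooth structure is a maximal smooth atlas; the manifold is the whole type \<open>'m\<close>.\<close>

definition smooth_manifold ::
    "('m::{t2_space,second_countable_topology}, 'n::finite) chart set \<Rightarrow> bool" where
  "smooth_manifold A \<longleftrightarrow>
     (\<forall>C\<in>A. is_chart C) \<and> (\<Union>C\<in>A. fst C) = UNIV \<and>
     (\<forall>C\<in>A. \<forall>D\<in>A. smooth_compatible C D) \<and>
     (\<forall>C. is_chart C \<and> (\<forall>D\<in>A. smooth_compatible C D) \<longrightarrow> C \<in> A)"

text \<open>Smooth maps on an open subset \<open>U\<close> with values in a normed space. As functions are total,
  their values outside \<open>U\<close> carry no meaning. With values in \<open>real\<close>, \<open>real ^ 'n\<close> and the
  multivectors below these are the spaces S(U), V(U) and M(U).\<close>

definition smooth_fields ::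
    "('m::topological_space, 'n::finite) chart set \<Rightarrow> 'm set \<Rightarrow> ('m \<Rightarrow> 'v::real_normed_vector) set" where
  "smooth_fields A U = {X. \<forall>(V, \<psi>)\<in>A. smooth_on (\<psi> ` (U \<inter> V)) (X \<circ> inv_into V \<psi>)}"

section \<open>The canonical space and its exterior algebra\<close>

text \<open>The canonical space is \<open>real ^ 'n\<close> with its standard scalar product; the order on the index
  type is used only to fix the signs of the exterior products of basis vectors.\<close>

type_synonym 'n canonical = "real ^ 'n"

definition b :: "'n::finite \<Rightarrow> 'n canonical" where
  "b \<mu> = axis \<mu> 1"

text \<open>A multivector is given by its components with respect to the basis of the products
  \<open>b i1 \<and> \<dots> \<and> b ik\<close>, \<open>i1 < \<dots> < ik\<close>, indexed by the sets \<open>{i1, \<dots>, ik}\<close>.\<close>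

type_synonym 'n multivector = "real ^ ('n set)"

text \<open>The sign of the permutation that sorts the increasing enumeration of \<open>I\<close> followed by
  that of \<open>J\<close>.\<close>

definition shuffle_sign :: "'n::{finite,linorder} set \<Rightarrow> 'n set \<Rightarrow> real" where
  "shuffle_sign I J = (-1) ^ card {(i, j). i \<in> I \<and> j \<in> J \<and> j < i}"

definition wedge ::
    "'n::{finite,linorder} multivector \<Rightarrow> 'n multivector \<Rightarrow> 'n multivector"
    (infixl "\<^bold>\<and>" 70) where
  "X \<^bold>\<and> Y = (\<chi> K. \<Sum>I\<in>Pow K. shuffle_sign I (K - I) * (X $ I * Y $ (K - I)))"

definition mv :: "'n canonical \<Rightarrow> 'n::{finite,linorder} multivector" where
  "mv v = (\<Sum>\<mu>\<in>UNIV. (v $ \<mu>) *\<^sub>R axis {\<mu>} 1)"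

text \<open>The following facts, together with the dimension \<open>2 ^ CARD('n)\<close>, confirm that this is the
  exterior algebra.\<close>

lemma bilinear_wedge: "bilinear (\<^bold>\<and>)"
  unfolding bilinear_def
  by (auto intro!: linearI
      simp: wedge_def vec_eq_iff algebra_simps sum.distrib sum_distrib_left)

lemma linear_mv: "linear mv"
  by (auto intro!: linearI simp: mv_def algebra_simps sum.distrib scaleR_sum_right)

lemma shuffle_sign_empty [simp]: "shuffle_sign {} J = 1" "shuffle_sign I {} = 1"
  by (simp_all add: shuffle_sign_def)

lemma shuffle_sign_Un_left:
  assumes "I \<inter> J = {}"
  shows "shuffle_sign (I \<union> J) K = shuffle_sign I K * shuffle_sign J K"
proof -
  have "{(i, j). i \<in> I \<union> J \<and> j \<in> K \<and> j < i} =
      {(i, j). i \<in> I \<and> j \<in> K \<and> j < i} \<union> {(i, j). i \<in> J \<and> j \<in> K \<and> j < i}"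
    by auto
  moreover have "{(i, j). i \<in> I \<and> j \<in> K \<and> j < i} \<inter> {(i, j). i \<in> J \<and> j \<in> K \<and> j < i} = {}"
    using assms by auto
  ultimately show ?thesis
    by (simp add: shuffle_sign_def card_Un_disjoint power_add)
qed

lemma shuffle_sign_Un_right:
  assumes "J \<inter> K = {}"
  shows "shuffle_sign I (J \<union> K) = shuffle_sign I J * shuffle_sign I K"
proof -
  have "{(i, j). i \<in> I \<and> j \<in> J \<union> K \<and> j < i} =
      {(i, j). i \<in> I \<and> j \<in> J \<and> j < i} \<union> {(i, j). i \<in> I \<and> j \<in> K \<and> j < i}"
    by auto
  moreover have "{(i, j). i \<in> I \<and> j \<in> J \<and> j < i} \<inter> {(i, j). i \<in> I \<and> j \<in> K \<and> j < i} = {}"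
    using assms by auto
  ultimately show ?thesis
    by (simp add: shuffle_sign_def card_Un_disjoint power_add)
qed

lemma wedge_assoc: "(X \<^bold>\<and> Y) \<^bold>\<and> Z = X \<^bold>\<and> (Y \<^bold>\<and> Z)"
proof -
  have "((X \<^bold>\<and> Y) \<^bold>\<and> Z) $ K = (X \<^bold>\<and> (Y \<^bold>\<and> Z)) $ K" for K
  proof -
    let ?s = shuffle_sign
    have "((X \<^bold>\<and> Y) \<^bold>\<and> Z) $ K = (\<Sum>(P, I)\<in>(SIGMA P:Pow K. Pow P).
        ?s P (K - P) * ?s I (P - I) * (X $ I * Y $ (P - I) * Z $ (K - P)))"
      by (simp add: wedge_def sum_distrib_left sum_distrib_right mult_ac flip: sum.Sigma)
    also have "\<dots> = (\<Sum>(I, J)\<in>(SIGMA I:Pow K. Pow (K - I)).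
        ?s I (K - I) * ?s J (K - I - J) * (X $ I * Y $ J * Z $ (K - I - J)))"
    proof (rule sum.reindex_bij_witness
        [where j = "\<lambda>(P, I). (I, P - I)" and i = "\<lambda>(I, J). (I \<union> J, I)"], goal_cases)
      case (5 a)
      obtain P I where a: "a = (P, I)" "P \<subseteq> K" "I \<subseteq> P" using 5 by auto
      have 1: "K - I - (P - I) = K - P" "K - I = (P - I) \<union> (K - P)" using a by auto
      have "?s P (K - P) = ?s I (K - P) * ?s (P - I) (K - P)"
        using shuffle_sign_Un_left[of I "P - I" "K - P"] a by (simp add: Un_absorb1)
      moreover have "?s I (K - I) = ?s I (P - I) * ?s I (K - P)"
        unfolding 1(2) by (rule shuffle_sign_Un_right) auto
      ultimately show ?case using a 1(1) by simp
    qed auto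
    also have "\<dots> = (X \<^bold>\<and> (Y \<^bold>\<and> Z)) $ K"
      by (simp add: wedge_def sum_distrib_left mult_ac flip: sum.Sigma)
    finally show ?thesis .
  qed
  then show ?thesis by (simp add: vec_eq_iff)
qed

lemma wedge_axis_axis:
  "axis I 1 \<^bold>\<and> axis J 1 = (if I \<inter> J = {} then shuffle_sign I J *\<^sub>R axis (I \<union> J) 1 else 0)"
proof -
  have "(axis I 1 \<^bold>\<and> axis J 1) $ K =
      (if I \<inter> J = {} then shuffle_sign I J *\<^sub>R axis (I \<union> J) 1 else 0) $ K" for K
  proof -
    have "(axis I 1 \<^bold>\<and> axis J 1) $ K =
        (\<Sum>L\<in>Pow K. if L = I then shuffle_sign I (K - I) * (if K - I = J then 1 else 0) else 0)"
      unfolding wedge_def vec_lambda_beta by (rule sum.cong) (auto simp: axis_def)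
    also have "\<dots> = (if I \<subseteq> K \<and> K - I = J then shuffle_sign I J else 0)"
      by (auto simp: sum.delta)
    also have "I \<subseteq> K \<and> K - I = J \<longleftrightarrow> I \<inter> J = {} \<and> K = I \<union> J" by auto
    finally show ?thesis by (auto simp: axis_def)
  qed
  then show ?thesis by (simp add: vec_eq_iff)
qed

lemma wedge_unit_left: "axis {} 1 \<^bold>\<and> X = X"
proof -
  have "(axis {} 1 \<^bold>\<and> X) $ K = X $ K" for K
  proof -
    have "(axis {} 1 \<^bold>\<and> X) $ K = (\<Sum>L\<in>Pow K. if L = {} then X $ K else 0)"
      unfolding wedge_def vec_lambda_beta
      by (rule sum.cong) (auto simp: axis_def)
    then show ?thesis by (simp add: sum.delta)
  qed
  then show ?thesis by (simp add: vec_eq_iff)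
qed

lemma wedge_unit_right: "X \<^bold>\<and> axis {} 1 = X"
proof -
  have "(X \<^bold>\<and> axis {} 1) $ K = X $ K" for K
  proof -
    have "(X \<^bold>\<and> axis {} 1) $ K = (\<Sum>L\<in>Pow K. if L = K then X $ K else 0)"
      unfolding wedge_def vec_lambda_beta
      by (rule sum.cong) (auto simp: axis_def)
    then show ?thesis by (simp add: sum.delta)
  qed
  then show ?thesis by (simp add: vec_eq_iff)
qed

lemma mv_b: "mv (b \<mu>) = axis {\<mu>} 1"
proof -
  have "mv (b \<mu>) = (\<Sum>\<nu>\<in>UNIV. if \<nu> = \<mu> then axis {\<mu>} 1 else 0)"
    unfolding mv_def b_def by (rule sum.cong) (auto simp: axis_def)
  then show ?thesis by (simp add: sum.delta)
qed

lemma wedge_b_anticommute: "mv (b \<mu>) \<^bold>\<and> mv (b \<nu>) = - (mv (b \<nu>) \<^bold>\<and> mv (b \<mu>))"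
proof -
  have "{(i, j). i = \<mu> \<and> j = \<nu> \<and> j < i} = (if \<nu> < \<mu> then {(\<mu>, \<nu>)} else {})" for \<mu> \<nu> :: 'a
    by auto
  then have "shuffle_sign {\<mu>} {\<nu>} = (if \<nu> < \<mu> then -1 else 1)" for \<mu> \<nu> :: 'a
    by (simp add: shuffle_sign_def)
  then show ?thesis
    by (auto simp: mv_b wedge_axis_axis insert_commute)
qed

lemma wedge_mv_self: "mv v \<^bold>\<and> mv v = 0"
proof -
  interpret wedge: bounded_bilinear "(\<^bold>\<and>) :: 'a multivector \<Rightarrow> _"
    by (simp add: bilinear_wedge flip: bilinear_conv_bounded_bilinear)
  have mv: "mv v = (\<Sum>\<mu>\<in>UNIV. (v $ \<mu>) *\<^sub>R mv (b \<mu>))"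
    by (simp add: mv_b) (simp add: mv_def)
  let ?S = "\<Sum>\<mu>\<in>UNIV. \<Sum>\<nu>\<in>UNIV. (v $ \<mu> * v $ \<nu>) *\<^sub>R (mv (b \<mu>) \<^bold>\<and> mv (b \<nu>))"
  have "mv v \<^bold>\<and> mv v = ?S"
    unfolding mv
    by (subst sum.swap) (simp add: wedge.sum_left wedge.sum_right wedge.scaleR_left
        wedge.scaleR_right scaleR_sum_right mult.commute)
  moreover have "?S = - ?S"
  proof -
    have "?S = (\<Sum>\<nu>\<in>UNIV. \<Sum>\<mu>\<in>UNIV. (v $ \<mu> * v $ \<nu>) *\<^sub>R (mv (b \<mu>) \<^bold>\<and> mv (b \<nu>)))"
      by (rule sum.swap)
    also have "\<dots> = (\<Sum>\<nu>\<in>UNIV. \<Sum>\<mu>\<in>UNIV. - ((v $ \<nu> * v $ \<mu>) *\<^sub>R (mv (b \<nu>) \<^bold>\<and> mv (b \<mu>))))"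
    proof (intro sum.cong refl)
      fix \<mu> \<nu> :: 'a
      show "(v $ \<mu> * v $ \<nu>) *\<^sub>R (mv (b \<mu>) \<^bold>\<and> mv (b \<nu>)) =
          - ((v $ \<nu> * v $ \<mu>) *\<^sub>R (mv (b \<nu>) \<^bold>\<and> mv (b \<mu>)))"
        by (subst wedge_b_anticommute) (simp add: mult.commute)
    qed
    finally show ?thesis by (simp add: sum_negf)
  qed
  moreover have "x = 0" if "x = - x" for x :: "'a multivector"
    using that by (simp add: vec_eq_iff)
  ultimately show ?thesis by simp
qed

section \<open>Derivatives in a chart\<close>

text \<open>In what follows \<open>C = (U\<^sub>o, \<phi>\<^sub>o)\<close> is the chart and \<open>p\<close> a point of its domain.\<close>

type_synonym ('m, 'n) vfield = "'m \<Rightarrow> 'n canonical"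

definition partial :: "('m, 'n::finite) chart \<Rightarrow> 'n \<Rightarrow> ('m \<Rightarrow> 'v::real_normed_vector) \<Rightarrow> 'm \<Rightarrow> 'v" where
  "partial = (\<lambda>(U\<^sub>o, \<phi>\<^sub>o) \<mu> X p.
     vector_derivative (\<lambda>t. X (inv_into U\<^sub>o \<phi>\<^sub>o (\<phi>\<^sub>o p + t *\<^sub>R axis \<mu> 1))) (at 0))"

definition dir_deriv ::
    "('m, 'n::finite) chart \<Rightarrow> ('m, 'n) vfield \<Rightarrow> ('m \<Rightarrow> 'v::real_normed_vector) \<Rightarrow> 'm \<Rightarrow> 'v" where
  "dir_deriv C a X p = (\<Sum>\<mu>\<in>UNIV. (a p \<bullet> b \<mu>) *\<^sub>R partial C \<mu> X p)"

definition curl ::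
    "('m, 'n::{finite,linorder}) chart \<Rightarrow> ('m \<Rightarrow> 'n multivector) \<Rightarrow> 'm \<Rightarrow> 'n multivector" where
  "curl C X p = (\<Sum>\<mu>\<in>UNIV. mv (b \<mu>) \<^bold>\<and> partial C \<mu> X p)"

definition lie_bracket ::
    "('m, 'n::finite) chart \<Rightarrow> ('m, 'n) vfield \<Rightarrow> ('m, 'n) vfield \<Rightarrow> ('m, 'n) vfield" where
  "lie_bracket C u v p = dir_deriv C u v p - dir_deriv C v u p"

section \<open>Parallelism structures\<close>

type_synonym ('m, 'n) connection = "'m \<Rightarrow> 'n canonical \<Rightarrow> 'n canonical \<Rightarrow> 'n canonical"

text \<open>The bilinear maps form a finite-dimensional space, so smoothness of \<open>\<gamma>\<close> amounts to
  smoothness of all its evaluations.\<close>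

definition parallelism_structure ::
    "('m::topological_space, 'n::finite) chart set \<Rightarrow> 'm set \<Rightarrow> ('m, 'n) connection \<Rightarrow> bool" where
  "parallelism_structure A U \<gamma> \<longleftrightarrow> open U \<and> (\<forall>p\<in>U. bilinear (\<gamma> p)) \<and>
     (\<forall>u v. (\<lambda>p. \<gamma> p u v) \<in> smooth_fields A U)"

definition nabla_plus ::
    "('m, 'n::finite) chart \<Rightarrow> ('m, 'n) connection \<Rightarrow> ('m, 'n) vfield \<Rightarrow> ('m, 'n) vfield \<Rightarrow> ('m, 'n) vfield"
  where "nabla_plus C \<gamma> u v p = dir_deriv C u v p + \<gamma> p (u p) (v p)"

definition nabla_minus ::
    "('m, 'n::finite) chart \<Rightarrow> ('m, 'n) connection \<Rightarrow> ('m, 'n) vfield \<Rightarrow> ('m, 'n) vfield \<Rightarrow> ('m, 'n) vfield"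
  where "nabla_minus C \<gamma> u v p = dir_deriv C u v p - adjoint (\<gamma> p (u p)) (v p)"

definition torsion ::
    "('m, 'n::finite) chart \<Rightarrow> ('m, 'n) connection \<Rightarrow> ('m, 'n) vfield \<Rightarrow> ('m, 'n) vfield \<Rightarrow> ('m, 'n) vfield"
  where "torsion C \<gamma> u v p = nabla_plus C \<gamma> u v p - nabla_plus C \<gamma> v u p - lie_bracket C u v p"

lemma torsion_eq: "torsion C \<gamma> u v p = \<gamma> p (u p) (v p) - \<gamma> p (v p) (u p)"
  by (simp add: torsion_def nabla_plus_def lie_bracket_def)

definition cartan_torsion ::
    "('m, 'n::{finite,linorder}) chart \<Rightarrow> ('m, 'n) connection \<Rightarrow> ('m, 'n) vfield \<Rightarrow> 'm \<Rightarrow> 'n multivector"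
  where "cartan_torsion C \<gamma> c p = (1 / 2) *\<^sub>R (\<Sum>\<mu>\<in>UNIV. \<Sum>\<nu>\<in>UNIV.
     (torsion C \<gamma> (\<lambda>_. b \<mu>) (\<lambda>_. b \<nu>) p \<bullet> c p) *\<^sub>R (mv (b \<mu>) \<^bold>\<and> mv (b \<nu>)))"

definition cartan_connection_minus ::
    "('m, 'n::finite) chart \<Rightarrow> ('m, 'n) connection \<Rightarrow> ('m, 'n) vfield \<Rightarrow> ('m, 'n) vfield \<Rightarrow> ('m, 'n) vfield"
  where "cartan_connection_minus C \<gamma> u c p =
     (\<Sum>\<mu>\<in>UNIV. (u p \<bullet> nabla_minus C \<gamma> (\<lambda>_. b \<mu>) c p) *\<^sub>R b \<mu>)"

end

theory Submission
  imports Defs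
begin

text \<open>Expanding everything in the basis, \<open>\<Theta>(c)\<close> is the sum of
  \<open>(\<gamma>(b\<^sub>\<mu>, b\<^sub>\<nu>) \<cdot> c) b\<^sub>\<mu> \<and> b\<^sub>\<nu>\<close>, because antisymmetry of the wedge product makes both halves of the
  torsion contribute equally. In \<open>\<partial>\<^sub>s \<and> \<gamma>\<^sup>-(s, c)\<close> the two indices occur in the opposite order, so that
  its connection part is \<open>\<Theta>(c)\<close> and its derivative part is \<open>- \<partial>\<^sub>o \<and> c\<close>.\<close>

text \<open>A homeomorphism onto its image is an open map into that image, and the image of a chart
  domain is itself open in coordinate space.\<close>

lemma open_chart_image:
  assumes "is_chart (V, \<psi>)" "open U" "U \<subseteq> V"
  shows "open (\<psi> ` U)"
proof -
  have V: "open V" "open (\<psi> ` V)" "homeomorphism V (\<psi> ` V) \<psi> (inv_into V \<psi>)"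
    using assms(1) by (auto simp: is_chart_def)
  have "openin (top_of_set V) U"
    using assms(2,3) V(1) by (simp add: openin_open_eq)
  then have "openin (top_of_set (\<psi> ` V)) (\<psi> ` U)"
    by (rule homeomorphism_imp_open_map[OF V(3)])
  then show ?thesis
    using V(2) by (simp add: openin_open_eq)
qed

text \<open>Smoothness is read in the given chart at level \<open>Suc 0\<close> of
  \<open>Ck_on\<close>; openness of the coordinate image turns differentiability on a set into
  differentiability at a point.\<close>

lemma smooth_fields_differentiable:
  assumes "is_chart (V, \<psi>)" "(V, \<psi>) \<in> A" "open U" "U \<subseteq> V" "X \<in> smooth_fields A U" "p \<in> U"
  shows "(X \<circ> inv_into V \<psi>) differentiable (at (\<psi> p))"
proof -
  have "smooth_on (\<psi> ` (U \<inter> V)) (X \<circ> inv_into V \<psi>)"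
    using assms(2,5) by (auto simp: smooth_fields_def)
  then have "Ck_on (Suc 0) (\<psi> ` U) (X \<circ> inv_into V \<psi>)"
    using assms(4) by (simp add: smooth_on_def Int_absorb2)
  then have "(X \<circ> inv_into V \<psi>) differentiable_on \<psi> ` U"
    by simp
  then show ?thesis
    using open_chart_image[OF assms(1,3,4)] assms(6)
    by (simp add: differentiable_on_eq_differentiable_at)
qed

text \<open>\<open>partial\<close> is a velocity along a coordinate line, and bounded linear maps
  commute with velocities. Differentiability ensures that the velocity exists, so that
  \<open>vector_derivative\<close> is not an arbitrary value.\<close>

lemma partial_bounded_linear:
  assumes "bounded_linear L" "(X \<circ> inv_into V \<psi>) differentiable (at (\<psi> p))"
  shows "partial (V, \<psi>) \<mu> (\<lambda>q. L (X q)) p = L (partial (V, \<psi>) \<mu> X p)"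
proof -
  let ?l = "\<lambda>t::real. \<psi> p + t *\<^sub>R axis \<mu> 1"
  have "?l differentiable (at 0)"
    by (intro derivative_intros)
  moreover have "(X \<circ> inv_into V \<psi>) differentiable (at (?l 0))"
    using assms(2) by simp
  ultimately have "((X \<circ> inv_into V \<psi>) \<circ> ?l) differentiable (at 0)"
    by (rule differentiable_chain_at)
  then have "((\<lambda>t. X (inv_into V \<psi> (?l t))) has_vector_derivative partial (V, \<psi>) \<mu> X p) (at 0)"
    by (simp add: partial_def o_def vector_derivative_works)
  then have "((\<lambda>t. L (X (inv_into V \<psi> (?l t)))) has_vector_derivative
      L (partial (V, \<psi>) \<mu> X p)) (at 0)"
    by (rule bounded_linear.has_vector_derivative[OF assms(1)])
  then show ?thesis
    by (simp add: partial_def vector_derivative_at)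
qed

lemma b_inner_b: "b \<mu> \<bullet> b \<nu> = (if \<mu> = \<nu> then 1 else 0)"
  by (simp add: b_def inner_axis_axis)

lemma dir_deriv_b: "dir_deriv C (\<lambda>_. b \<mu>) X p = partial C \<mu> X p"
  by (simp add: dir_deriv_def b_inner_b if_distrib[of "\<lambda>r. r *\<^sub>R _"] cong: if_cong)

lemma wedge_sum_scaleR_right:
  "X \<^bold>\<and> (\<Sum>i\<in>S. r i *\<^sub>R Y i) = (\<Sum>i\<in>S. r i *\<^sub>R (X \<^bold>\<and> Y i))"
proof -
  interpret wedge: bounded_bilinear "(\<^bold>\<and>) :: 'a multivector \<Rightarrow> _"
    by (simp add: bilinear_wedge flip: bilinear_conv_bounded_bilinear)
  show ?thesis
    by (simp add: wedge.sum_right wedge.scaleR_right)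
qed

lemma mv_expand: "mv v = (\<Sum>\<nu>\<in>UNIV. (b \<nu> \<bullet> v) *\<^sub>R mv (b \<nu>))"
  by (simp add: mv_b) (simp add: mv_def b_def inner_axis')

text \<open>Exchanging the two summations moves the transposition of indices from the coefficients
  to the wedge product, where anticommutativity yields the sign.\<close>

lemma sum_wedge_b_swap:
  "(\<Sum>\<mu>\<in>UNIV. \<Sum>\<nu>\<in>UNIV. F \<nu> \<mu> *\<^sub>R (mv (b \<mu>) \<^bold>\<and> mv (b \<nu>))) =
    - (\<Sum>\<mu>\<in>UNIV. \<Sum>\<nu>\<in>UNIV. F \<mu> \<nu> *\<^sub>R (mv (b \<mu>) \<^bold>\<and> mv (b \<nu>)))"
proof -
  have "F \<nu> \<mu> *\<^sub>R (mv (b \<mu>) \<^bold>\<and> mv (b \<nu>)) = - (F \<nu> \<mu> *\<^sub>R (mv (b \<nu>) \<^bold>\<and> mv (b \<mu>)))" for \<mu> \<nu>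
    by (subst wedge_b_anticommute) simp
  then show ?thesis
    by (subst sum.swap) (simp add: sum_negf)
qed

lemma cartan_torsion_eq:
  "cartan_torsion C \<gamma> c p =
    (\<Sum>\<mu>\<in>UNIV. \<Sum>\<nu>\<in>UNIV. (\<gamma> p (b \<mu>) (b \<nu>) \<bullet> c p) *\<^sub>R (mv (b \<mu>) \<^bold>\<and> mv (b \<nu>)))"
proof -
  \<comment> \<open>Doubling clears the factor 1/2. The second sum is the first with transposed
    coefficients, hence its negative.\<close>
  have "2 *\<^sub>R cartan_torsion C \<gamma> c p =
      (\<Sum>\<mu>\<in>UNIV. \<Sum>\<nu>\<in>UNIV. (\<gamma> p (b \<mu>) (b \<nu>) \<bullet> c p) *\<^sub>R (mv (b \<mu>) \<^bold>\<and> mv (b \<nu>))) -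
      (\<Sum>\<mu>\<in>UNIV. \<Sum>\<nu>\<in>UNIV. (\<gamma> p (b \<nu>) (b \<mu>) \<bullet> c p) *\<^sub>R (mv (b \<mu>) \<^bold>\<and> mv (b \<nu>)))"
    by (simp add: cartan_torsion_def torsion_eq inner_diff_left scaleR_diff_left sum_subtractf)
  also have "\<dots> = 2 *\<^sub>R
      (\<Sum>\<mu>\<in>UNIV. \<Sum>\<nu>\<in>UNIV. (\<gamma> p (b \<mu>) (b \<nu>) \<bullet> c p) *\<^sub>R (mv (b \<mu>) \<^bold>\<and> mv (b \<nu>)))"
    by (subst sum_wedge_b_swap[of "\<lambda>\<mu> \<nu>. \<gamma> p (b \<mu>) (b \<nu>) \<bullet> c p"]) (simp add: scaleR_2)
  finally show ?thesis by simp
qed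

text \<open>Pairing with \<open>u\<close> moves the adjoint off \<open>c\<close>: the direction
  \<open>b \<nu>\<close> stays the first argument of \<open>\<gamma> p\<close> and \<open>u\<close>
  becomes the second.\<close>

lemma wedge_cartan_connection_minus:
  assumes "bilinear (\<gamma> p)"
  shows "X \<^bold>\<and> mv (cartan_connection_minus C \<gamma> (\<lambda>_. u) c p) =
    (\<Sum>\<nu>\<in>UNIV. (u \<bullet> partial C \<nu> c p - \<gamma> p (b \<nu>) u \<bullet> c p) *\<^sub>R (X \<^bold>\<and> mv (b \<nu>)))"
proof -
  \<comment> \<open>The defining identity of \<open>adjoint\<close> is available for linear
    maps.\<close>
  have "linear (\<gamma> p (b \<nu>))" for \<nu>
    using assms by (simp add: bilinear_def)
  then have "u \<bullet> nabla_minus C \<gamma> (\<lambda>_. b \<nu>) c p = u \<bullet> partial C \<nu> c p - \<gamma> p (b \<nu>) u \<bullet> c p" for \<nu>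
    by (simp add: nabla_minus_def dir_deriv_b inner_diff_right adjoint_works)
  then show ?thesis
    by (simp add: cartan_connection_minus_def linear_sum[OF linear_mv] linear_scale[OF linear_mv]
        wedge_sum_scaleR_right)
qed

theorem mainTheorem2:
  fixes A :: "('m::{t2_space,second_countable_topology}, 'n::{finite,linorder}) chart set"
    and U\<^sub>o U :: "'m set"
    and \<phi>\<^sub>o :: "'m \<Rightarrow> 'n canonical"
    and \<gamma> :: "('m, 'n) connection"
    and c :: "('m, 'n) vfield"
  assumes "smooth_manifold A"
    and "(U\<^sub>o, \<phi>\<^sub>o) \<in> A"
    and "U \<subseteq> U\<^sub>o"
    and "parallelism_structure A U \<gamma>"
    and "c \<in> smooth_fields A U"
  shows "\<forall>p\<in>U. cartan_torsion (U\<^sub>o, \<phi>\<^sub>o) \<gamma> c p =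
    curl (U\<^sub>o, \<phi>\<^sub>o) (\<lambda>q. mv (c q)) p +
    (\<Sum>\<mu>\<in>UNIV. mv (b \<mu>) \<^bold>\<and> mv (cartan_connection_minus (U\<^sub>o, \<phi>\<^sub>o) \<gamma> (\<lambda>_. b \<mu>) c p))"
proof
  fix p assume p: "p \<in> U"
  have chart: "is_chart (U\<^sub>o, \<phi>\<^sub>o)"
    using assms(1,2) by (auto simp: smooth_manifold_def)
  have U: "open U" and bil: "bilinear (\<gamma> p)"
    using assms(4) p by (auto simp: parallelism_structure_def)
  let ?C = "(U\<^sub>o, \<phi>\<^sub>o)"
  let ?e = "\<lambda>\<mu> \<nu>. mv (b \<mu>) \<^bold>\<and> mv (b \<nu>) :: 'n multivector"
  let ?P = "\<Sum>\<mu>\<in>UNIV. \<Sum>\<nu>\<in>UNIV. (b \<nu> \<bullet> partial ?C \<mu> c p) *\<^sub>R ?e \<mu> \<nu>"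
  let ?G = "\<Sum>\<mu>\<in>UNIV. \<Sum>\<nu>\<in>UNIV. (\<gamma> p (b \<mu>) (b \<nu>) \<bullet> c p) *\<^sub>R ?e \<mu> \<nu>"
  have "bounded_linear (mv :: 'n canonical \<Rightarrow> _)"
    by (simp add: linear_mv linear_conv_bounded_linear[symmetric])
  \<comment> \<open>Smoothness of \<open>c\<close> enters here: it lets \<open>mv\<close> pass
    through the derivative, so the curl is expressed by partial derivatives of \<open>c\<close>
    itself.\<close>
  then have "partial ?C \<mu> (\<lambda>q. mv (c q)) p = mv (partial ?C \<mu> c p)" for \<mu>
    by (rule partial_bounded_linear)
      (rule smooth_fields_differentiable[OF chart assms(2) U assms(3,5) p])
  then have curl: "curl ?C (\<lambda>q. mv (c q)) p = ?P"
    by (simp add: curl_def mv_expand[of "partial _ _ _ _"] wedge_sum_scaleR_right)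
  have "(\<Sum>\<mu>\<in>UNIV. mv (b \<mu>) \<^bold>\<and> mv (cartan_connection_minus ?C \<gamma> (\<lambda>_. b \<mu>) c p)) =
      (\<Sum>\<mu>\<in>UNIV. \<Sum>\<nu>\<in>UNIV. (b \<mu> \<bullet> partial ?C \<nu> c p) *\<^sub>R ?e \<mu> \<nu>) -
      (\<Sum>\<mu>\<in>UNIV. \<Sum>\<nu>\<in>UNIV. (\<gamma> p (b \<nu>) (b \<mu>) \<bullet> c p) *\<^sub>R ?e \<mu> \<nu>)"
    by (simp add: wedge_cartan_connection_minus[where c = c and \<gamma> = \<gamma>, OF bil] scaleR_diff_left
        sum_subtractf)
  \<comment> \<open>Both sums carry coefficients transposed relative to \<open>?P\<close> and
    \<open>?G\<close>. Each swap costs a sign, which reverses the difference; \<open>?P\<close> then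
    cancels against the curl.\<close>
  also have "\<dots> = ?G - ?P"
    using sum_wedge_b_swap[of "\<lambda>\<mu> \<nu>. b \<nu> \<bullet> partial ?C \<mu> c p"]
      sum_wedge_b_swap[of "\<lambda>\<mu> \<nu>. \<gamma> p (b \<mu>) (b \<nu>) \<bullet> c p"]
    by simp
  finally show "cartan_torsion ?C \<gamma> c p = curl ?C (\<lambda>q. mv (c q)) p +
      (\<Sum>\<mu>\<in>UNIV. mv (b \<mu>) \<^bold>\<and> mv (cartan_connection_minus ?C \<gamma> (\<lambda>_. b \<mu>) c p))"
    by (simp add: curl cartan_torsion_eq)
qed

end
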